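(* Let $D=(\Sigma,A)$ be a decoder with $|\Sigma|=k$. A graph $G=(V,E)$ is a letter graph over $D$ if and only if there exists a letter assignment $\ell:V\to\Sigma$ such that (C1) for every $a\in\Sigma$ with $|\ell^{-1}(a)|\ge 2$, the set $\ell^{-1}(a)$ is a clique if and only if $(a,a)\in A$; (C2) for every $a\in\Sigma$ with $|\ell^{-1}(a)|\ge 2$, the set $\ell^{-1}(a)$ is an independent set if and only if $(a,a)\notin A$; (C3) for any two distinct $a,b\in\Sigma$: if $(a,b),(b,a)\in A$ then the bipartite graph $G[\ell^{-1}(a),\ell^{-1}(b)]$ is complete bipartite, and if $(a,b),(b,a)\notin A$ then it is edgeless; (C4) the compatibility graph $\mathsf{CG}(G,D,\ell)$ is acyclic. Moreover, if $\ell$ satisfies (C1)–(C4), then for any topological ordering $\pi$ of $\mathsf{CG}(G,D,\ell)$, the pair $(\ell,\pi)$ is a letter realisation of $G$ over $D$.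
   Context: A decoder is a directed graph $D=(\Sigma,A)$ (loops allowed) on a finite alphabet $\Sigma$. An $n$-vertex graph $G=(V,E)$ is a letter graph over $D$ if there exist a map $\ell:V\to\Sigma$ and a bijection $c:V\to[n]$ such that two distinct vertices $x,y$ are adjacent iff either $(\ell(x),\ell(y))\in A$ and $c(x)<c(y)$, or $(\ell(y),\ell(x))\in A$ and $c(y)<c(x)$; $(\ell,c)$ is then called a letter realisation of $G$ over $D$. For disjoint $X,Y\subseteq V$, $G[X,Y]$ is the bipartite graph on $X\cup Y$ with the edges of $G$ between $X$ and $Y$. The compatibility graph $\mathsf{CG}(G,D,\ell)$ is the directed graph with vertex set $V$ and arc set $\bigcup_{(a,b)\in A,\,(b,a)\notin A}\big(\{(x,y): \ell(x)=a,\ell(y)=b,xy\in E\}\cup\{(y,x):\ell(x)=a,\ell(y)=b,xy\notin E\}\big)$. A topological ordering of a directed graph on $n$ vertices is a bijection $\pi$ from its vertex set to $[n]$ with $\pi(x)<\pi(y)$ for every arc $(x,y)$. *)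

theory Defs
  imports "HOL-Library.FuncSet"
begin

text \<open>
  A simple graph is given by a vertex set \<open>V\<close> and a set \<open>E\<close> of two-element subsets of \<open>V\<close>;
  a directed graph by a vertex set and a binary relation (its arc set) on it, loops allowed.
\<close>

definition simple_graph :: "'v set \<Rightarrow> 'v set set \<Rightarrow> bool" where
  "simple_graph V E \<longleftrightarrow> finite V \<and> (\<forall>e\<in>E. e \<subseteq> V \<and> card e = 2)"

definition decoder :: "'a set \<Rightarrow> 'a rel \<Rightarrow> bool" where
  "decoder \<Sigma> A \<longleftrightarrow> finite \<Sigma> \<and> A \<subseteq> \<Sigma> \<times> \<Sigma>"

definition letter_realisation ::
  "'v set \<Rightarrow> 'v set set \<Rightarrow> 'a set \<Rightarrow> 'a rel \<Rightarrow> ('v \<Rightarrow> 'a) \<Rightarrow> ('v \<Rightarrow> nat) \<Rightarrow> bool" where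
  "letter_realisation V E \<Sigma> A l c \<longleftrightarrow>
     l \<in> V \<rightarrow> \<Sigma> \<and> bij_betw c V {1..card V} \<and>
     (\<forall>x\<in>V. \<forall>y\<in>V. x \<noteq> y \<longrightarrow>
        ({x, y} \<in> E \<longleftrightarrow> (l x, l y) \<in> A \<and> c x < c y \<or> (l y, l x) \<in> A \<and> c y < c x))"

definition letter_graph :: "'v set \<Rightarrow> 'v set set \<Rightarrow> 'a set \<Rightarrow> 'a rel \<Rightarrow> bool" where
  "letter_graph V E \<Sigma> A \<longleftrightarrow> (\<exists>l c. letter_realisation V E \<Sigma> A l c)"

definition letter_class :: "'v set \<Rightarrow> ('v \<Rightarrow> 'a) \<Rightarrow> 'a \<Rightarrow> 'v set" where
  "letter_class V l a = {x \<in> V. l x = a}"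

definition clique :: "'v set set \<Rightarrow> 'v set \<Rightarrow> bool" where
  "clique E X \<longleftrightarrow> (\<forall>x\<in>X. \<forall>y\<in>X. x \<noteq> y \<longrightarrow> {x, y} \<in> E)"

definition independent_set :: "'v set set \<Rightarrow> 'v set \<Rightarrow> bool" where
  "independent_set E X \<longleftrightarrow> (\<forall>x\<in>X. \<forall>y\<in>X. x \<noteq> y \<longrightarrow> {x, y} \<notin> E)"

text \<open>The edge set of the bipartite graph \<open>G[X,Y]\<close>, whose vertex set is \<open>X \<union> Y\<close>.\<close>

definition bipartite_edges :: "'v set set \<Rightarrow> 'v set \<Rightarrow> 'v set \<Rightarrow> 'v set set" where
  "bipartite_edges E X Y = {e \<in> E. \<exists>x\<in>X. \<exists>y\<in>Y. e = {x, y}}"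

text \<open>
  \<open>F\<close> is the edge set of the complete bipartite graph with parts \<open>X\<close> and \<open>Y\<close>;
  either part may be empty.
\<close>

definition complete_bipartite :: "'v set \<Rightarrow> 'v set \<Rightarrow> 'v set set \<Rightarrow> bool" where
  "complete_bipartite X Y F \<longleftrightarrow> F = {{x, y} | x y. x \<in> X \<and> y \<in> Y}"

text \<open>The arc set of \<open>CG(G,D,l)\<close>, whose vertex set is \<open>V\<close>.\<close>

definition CG_arcs :: "'v set \<Rightarrow> 'v set set \<Rightarrow> 'a rel \<Rightarrow> ('v \<Rightarrow> 'a) \<Rightarrow> 'v rel" where
  "CG_arcs V E A l =
     (\<Union>(a, b) \<in> {(a, b). (a, b) \<in> A \<and> (b, a) \<notin> A}.
        {(x, y) | x y. x \<in> V \<and> y \<in> V \<and> l x = a \<and> l y = b \<and> {x, y} \<in> E} \<union>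
        {(y, x) | x y. x \<in> V \<and> y \<in> V \<and> l x = a \<and> l y = b \<and> {x, y} \<notin> E})"

definition topological_ordering :: "'v set \<Rightarrow> 'v rel \<Rightarrow> ('v \<Rightarrow> nat) \<Rightarrow> bool" where
  "topological_ordering V R p \<longleftrightarrow>
     bij_betw p V {1..card V} \<and> (\<forall>(x, y)\<in>R. p x < p y)"

definition C1 :: "'v set \<Rightarrow> 'v set set \<Rightarrow> 'a set \<Rightarrow> 'a rel \<Rightarrow> ('v \<Rightarrow> 'a) \<Rightarrow> bool" where
  "C1 V E \<Sigma> A l \<longleftrightarrow>
     (\<forall>a\<in>\<Sigma>. card (letter_class V l a) \<ge> 2 \<longrightarrow>
        (clique E (letter_class V l a) \<longleftrightarrow> (a, a) \<in> A))"

definition C2 :: "'v set \<Rightarrow> 'v set set \<Rightarrow> 'a set \<Rightarrow> 'a rel \<Rightarrow> ('v \<Rightarrow> 'a) \<Rightarrow> bool" where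
  "C2 V E \<Sigma> A l \<longleftrightarrow>
     (\<forall>a\<in>\<Sigma>. card (letter_class V l a) \<ge> 2 \<longrightarrow>
        (independent_set E (letter_class V l a) \<longleftrightarrow> (a, a) \<notin> A))"

definition C3 :: "'v set \<Rightarrow> 'v set set \<Rightarrow> 'a set \<Rightarrow> 'a rel \<Rightarrow> ('v \<Rightarrow> 'a) \<Rightarrow> bool" where
  "C3 V E \<Sigma> A l \<longleftrightarrow>
     (\<forall>a\<in>\<Sigma>. \<forall>b\<in>\<Sigma>. a \<noteq> b \<longrightarrow>
        ((a, b) \<in> A \<and> (b, a) \<in> A \<longrightarrow>
           complete_bipartite (letter_class V l a) (letter_class V l b)
             (bipartite_edges E (letter_class V l a) (letter_class V l b))) \<and>
        ((a, b) \<notin> A \<and> (b, a) \<notin> A \<longrightarrow>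
           bipartite_edges E (letter_class V l a) (letter_class V l b) = {}))"

definition C4 :: "'v set \<Rightarrow> 'v set set \<Rightarrow> 'a rel \<Rightarrow> ('v \<Rightarrow> 'a) \<Rightarrow> bool" where
  "C4 V E A l \<longleftrightarrow> acyclic (CG_arcs V E A l)"

end

theory Submission
  imports Defs
begin

text \<open>
  For letters \<open>a\<close>, \<open>b\<close> joined by arcs in both directions or in neither, adjacency between the two
  classes does not depend on the ordering; for a single arc \<open>(a, b)\<close> the adjacency of \<open>x\<close> and \<open>y\<close>
  prescribes which of them comes first, and this prescription is an arc of the compatibility graph.
  Hence, once the symmetric pairs are right, an ordering realises \<open>G\<close> iff it is a topological
  ordering, and a finite directed graph has a topological ordering iff it is acyclic.
\<close>

text \<open>Induction by removing a sink: a finite nonempty acyclic digraph has a vertex without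
  outgoing arcs, and that vertex can safely take the last position.\<close>

lemma acyclic_imp_topological_ordering:
  assumes "finite V" "acyclic R" "R \<subseteq> V \<times> V"
  shows "\<exists>p. topological_ordering V R p"
  using assms
proof (induction V arbitrary: R rule: finite_remove_induct)
  case empty
  then show ?case by (auto simp: topological_ordering_def bij_betw_def)
next
  case (remove V)
  have "finite R" using remove by (meson finite_SigmaI finite_subset)
  then have "wf (R\<inverse>)" using remove.prems finite_acyclic_wf_converse by blast
  \<comment> \<open>A minimal element for the converse of \<open>R\<close> is a sink of
    \<open>R\<close>.\<close>
  then obtain m where m: "m \<in> V" "\<And>y. (m, y) \<in> R \<Longrightarrow> y \<notin> V"
    using \<open>V \<noteq> {}\<close> by (metis converse_iff ex_in_conv wfE_min)
  let ?W = "V - {m}" and ?n = "card V"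
  have card_W: "?n = Suc (card ?W)" using card.remove[OF \<open>finite V\<close> m(1)] .
  have "acyclic (R \<inter> ?W \<times> ?W)" using remove.prems acyclic_subset by blast
  then obtain p where p: "topological_ordering ?W (R \<inter> ?W \<times> ?W) p"
    using remove.IH[OF m(1)] by blast
  let ?q = "p(m := ?n)"
  have p_bij: "bij_betw p ?W {1..card ?W}" using p by (simp add: topological_ordering_def)
  then have "bij_betw ?q ?W {1..card ?W}" by (rule bij_betw_cong[THEN iffD1, rotated]) auto
  then have "bij_betw ?q (insert m ?W) (insert ?n {1..card ?W})"
    using card_W notIn_Un_bij_betw[of m ?W ?q "{1..card ?W}"] by simp
  moreover have "insert m ?W = V" using m by blast
  moreover have "insert ?n {1..card ?W} = {1..?n}" using card_W by auto
  ultimately have "bij_betw ?q V {1..?n}" by simp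
  moreover have "?q x < ?q y" if xy: "(x, y) \<in> R" for x y
  proof -
    \<comment> \<open>The tail \<open>x\<close> of an arc differs from \<open>m\<close>, since
      \<open>m\<close> is a sink; only the head can be \<open>m\<close>, and then it has the largest
      value.\<close>
    have x: "x \<in> ?W" and y: "y \<in> V" using xy m remove.prems by auto
    show ?thesis
    proof (cases "y = m")
      case True
      have "p x \<in> {1..card ?W}" using p_bij x by (meson bij_betwE)
      then show ?thesis using x True card_W by auto
    next
      case False
      then show ?thesis using p x y xy by (auto simp: topological_ordering_def)
    qed
  qed
  ultimately show ?case by (auto simp: topological_ordering_def)
qed

text \<open>Positions increase along arcs, so \<open>R\<close> is contained in a well-founded
  relation.\<close>

lemma topological_ordering_imp_acyclic:
  assumes "topological_ordering V R p"
  shows "acyclic R"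
proof (rule acyclic_subset)
  show "acyclic (measure p)" by (rule wf_acyclic) simp
  show "R \<subseteq> measure p" using assms by (auto simp: topological_ordering_def)
qed

lemma CG_arcs_subset: "CG_arcs V E A l \<subseteq> V \<times> V"
  by (auto simp: CG_arcs_def)

text \<open>Renaming the pair in the non-edge part of the union makes both parts speak of an arc
  from \<open>x\<close> to \<open>y\<close>. In this form, if exactly one of
  \<open>(l x, l y)\<close> and \<open>(l y, l x)\<close> lies in \<open>A\<close>, then exactly one
  of \<open>(x, y)\<close> and \<open>(y, x)\<close> is an arc.\<close>

lemma CG_arcs_iff:
  "(x, y) \<in> CG_arcs V E A l \<longleftrightarrow> x \<in> V \<and> y \<in> V \<and>
     ((l x, l y) \<in> A \<and> (l y, l x) \<notin> A \<and> {x, y} \<in> E \<or>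
      (l y, l x) \<in> A \<and> (l x, l y) \<notin> A \<and> {x, y} \<notin> E)"
  by (auto simp: CG_arcs_def insert_commute)

text \<open>This discharges the guard of \<open>C1\<close> and \<open>C2\<close>. Finiteness
  matters: \<open>card\<close> of an infinite class would be 0.\<close>

lemma card_letter_class_ge_2:
  assumes "finite V" "x \<in> V" "y \<in> V" "x \<noteq> y" "l x = l y"
  shows "card (letter_class V l (l x)) \<ge> 2"
proof -
  have "{x, y} \<subseteq> letter_class V l (l x)" "finite (letter_class V l (l x))"
    using assms by (auto simp: letter_class_def)
  then have "card {x, y} \<le> card (letter_class V l (l x))" by (intro card_mono)
  then show ?thesis using assms by simp
qed

lemma card_ge_2_obtain:
  assumes "card X \<ge> 2"
  obtains x y where "x \<in> X" "y \<in> X" "x \<noteq> y"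
proof -
  have "finite X" using assms card.infinite by fastforce
  then have "\<not> (\<forall>x\<in>X. \<forall>y\<in>X. x = y)" using assms card_le_Suc0_iff_eq[of X] by simp
  then show thesis using that by blast
qed

text \<open>The order-free content of \<open>C1\<close>, \<open>C2\<close> and \<open>C3\<close> as
  a single condition on pairs of vertices: equal letters correspond to \<open>C1\<close> and
  \<open>C2\<close>, different letters to \<open>C3\<close>.\<close>

definition symmetric_pairs_ok :: "'v set \<Rightarrow> 'v set set \<Rightarrow> 'a rel \<Rightarrow> ('v \<Rightarrow> 'a) \<Rightarrow> bool" where
  "symmetric_pairs_ok V E A l \<longleftrightarrow>
     (\<forall>x\<in>V. \<forall>y\<in>V. x \<noteq> y \<longrightarrow> ((l x, l y) \<in> A \<longleftrightarrow> (l y, l x) \<in> A) \<longrightarrow>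
        ({x, y} \<in> E \<longleftrightarrow> (l x, l y) \<in> A))"

lemma C123_imp_symmetric_pairs_ok:
  assumes "finite V" "l \<in> V \<rightarrow> \<Sigma>" "C1 V E \<Sigma> A l" "C2 V E \<Sigma> A l" "C3 V E \<Sigma> A l"
  shows "symmetric_pairs_ok V E A l"
  unfolding symmetric_pairs_ok_def
proof (intro ballI impI)
  fix x y assume xy: "x \<in> V" "y \<in> V" "x \<noteq> y" and sym: "(l x, l y) \<in> A \<longleftrightarrow> (l y, l x) \<in> A"
  have lxy: "l x \<in> \<Sigma>" "l y \<in> \<Sigma>" using assms xy by auto
  have cls: "x \<in> letter_class V l (l x)" "y \<in> letter_class V l (l y)"
    using xy by (auto simp: letter_class_def)
  show "{x, y} \<in> E \<longleftrightarrow> (l x, l y) \<in> A"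
  proof (cases "l x = l y")
    case True
    then have two: "card (letter_class V l (l x)) \<ge> 2"
      using card_letter_class_ge_2 assms(1) xy by metis
    have "clique E (letter_class V l (l x)) \<longleftrightarrow> (l x, l x) \<in> A"
      "independent_set E (letter_class V l (l x)) \<longleftrightarrow> (l x, l x) \<notin> A"
      using two assms(3,4) lxy by (auto simp: C1_def C2_def)
    then show ?thesis
      using cls xy True unfolding clique_def independent_set_def by metis
  next
    case False
    let ?B = "bipartite_edges E (letter_class V l (l x)) (letter_class V l (l y))"
    have edge: "{x, y} \<in> E \<longleftrightarrow> {x, y} \<in> ?B"
      using cls by (auto simp: bipartite_edges_def)
    show ?thesis
    proof (cases "(l x, l y) \<in> A")
      case True
      then have "complete_bipartite (letter_class V l (l x)) (letter_class V l (l y)) ?B"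
        using assms(5) lxy False sym by (simp add: C3_def)
      then have "{x, y} \<in> ?B" using cls unfolding complete_bipartite_def by blast
      then show ?thesis using True edge by blast
    next
      case nA: False
      then have "?B = {}" using assms(5) lxy False sym by (simp add: C3_def)
      then show ?thesis using nA edge by blast
    qed
  qed
qed

lemma symmetric_pairs_ok_imp_C123:
  assumes "symmetric_pairs_ok V E A l"
  shows "C1 V E \<Sigma> A l" "C2 V E \<Sigma> A l" "C3 V E \<Sigma> A l"
proof -
  have same: "{x, y} \<in> E \<longleftrightarrow> (a, a) \<in> A"
    if "x \<in> letter_class V l a" "y \<in> letter_class V l a" "x \<noteq> y" for x y a
    using assms that by (auto simp: symmetric_pairs_ok_def letter_class_def)
  have "(clique E (letter_class V l a) \<longleftrightarrow> (a, a) \<in> A) \<and>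
        (independent_set E (letter_class V l a) \<longleftrightarrow> (a, a) \<notin> A)"
    if two: "card (letter_class V l a) \<ge> 2" for a
  proof -
    \<comment> \<open>All pairs in the class behave alike, so one pair of distinct vertices decides
      between clique and independent set. A class with at most one vertex would be both.\<close>
    obtain x y where "x \<in> letter_class V l a" "y \<in> letter_class V l a" "x \<noteq> y"
      using card_ge_2_obtain[OF two] .
    then show ?thesis using same unfolding clique_def independent_set_def by meson
  qed
  then show "C1 V E \<Sigma> A l" "C2 V E \<Sigma> A l" by (auto simp: C1_def C2_def)
  have distinct: "{x, y} \<in> E \<longleftrightarrow> (a, b) \<in> A"
    if "x \<in> letter_class V l a" "y \<in> letter_class V l b" "a \<noteq> b" "(a, b) \<in> A \<longleftrightarrow> (b, a) \<in> A"
    for x y a b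
    using assms that by (auto simp: symmetric_pairs_ok_def letter_class_def)
  show "C3 V E \<Sigma> A l"
    unfolding C3_def complete_bipartite_def bipartite_edges_def
  proof (intro ballI conjI impI)
    fix a b assume ab: "a \<noteq> b" and A: "(a, b) \<in> A \<and> (b, a) \<in> A"
    then have "{x, y} \<in> E" if "x \<in> letter_class V l a" "y \<in> letter_class V l b" for x y
      using distinct[OF that] by simp
    then show "{e \<in> E. \<exists>x\<in>letter_class V l a. \<exists>y\<in>letter_class V l b. e = {x, y}} =
        {{x, y} |x y. x \<in> letter_class V l a \<and> y \<in> letter_class V l b}"
      by auto
  next
    fix a b assume ab: "a \<noteq> b" and A: "(a, b) \<notin> A \<and> (b, a) \<notin> A"
    then have "{x, y} \<notin> E" if "x \<in> letter_class V l a" "y \<in> letter_class V l b" for x y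
      using distinct[OF that] by simp
    then show "{e \<in> E. \<exists>x\<in>letter_class V l a. \<exists>y\<in>letter_class V l b. e = {x, y}} = {}"
      by auto
  qed
qed

text \<open>The adjacency rule splits by pairs. For a symmetric pair of letters, injectivity of
  \<open>c\<close> makes exactly one of the two order conditions true, so the rule reduces to
  \<open>(l x, l y) \<in> A\<close>. For an asymmetric pair, it says that \<open>c\<close> respects
  the arc between the two vertices.\<close>

lemma letter_realisation_iff:
  "letter_realisation V E \<Sigma> A l c \<longleftrightarrow>
     l \<in> V \<rightarrow> \<Sigma> \<and> symmetric_pairs_ok V E A l \<and> topological_ordering V (CG_arcs V E A l) c"
  (is "?L \<longleftrightarrow> ?R")
proof
  assume L: ?L
  then have inj: "inj_on c V" by (auto simp: letter_realisation_def bij_betw_def)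
  have adj: "{x, y} \<in> E \<longleftrightarrow> (l x, l y) \<in> A \<and> c x < c y \<or> (l y, l x) \<in> A \<and> c y < c x"
    if "x \<in> V" "y \<in> V" "x \<noteq> y" for x y
    using L that by (simp add: letter_realisation_def)
  have lin: "c x < c y \<or> c y < c x" if "x \<in> V" "y \<in> V" "x \<noteq> y" for x y
    using inj that by (metis inj_onD linorder_neqE_nat)
  have "symmetric_pairs_ok V E A l"
    unfolding symmetric_pairs_ok_def using adj lin by blast
  moreover have "c x < c y" if "(x, y) \<in> CG_arcs V E A l" for x y
  proof -
    \<comment> \<open>A loop would need a letter pair that is asymmetric with itself.\<close>
    have "x \<noteq> y" using that by (auto simp: CG_arcs_iff)
    then show ?thesis using that adj lin unfolding CG_arcs_iff by blast
  qed
  ultimately show ?R using L by (auto simp: letter_realisation_def topological_ordering_def)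
next
  assume R: ?R
  then have inj: "inj_on c V" by (auto simp: topological_ordering_def bij_betw_def)
  have arc: "c x < c y" if "(x, y) \<in> CG_arcs V E A l" for x y
    using R that by (auto simp: topological_ordering_def)
  have "{x, y} \<in> E \<longleftrightarrow> (l x, l y) \<in> A \<and> c x < c y \<or> (l y, l x) \<in> A \<and> c y < c x"
    if xy: "x \<in> V" "y \<in> V" "x \<noteq> y" for x y
  proof (cases "(l x, l y) \<in> A \<longleftrightarrow> (l y, l x) \<in> A")
    case True
    have "c x \<noteq> c y" using inj xy by (auto dest: inj_onD)
    then show ?thesis using R True xy unfolding symmetric_pairs_ok_def
      by (metis linorder_neqE_nat)
  next
    case False
    \<comment> \<open>Edge or non-edge, the pair carries an arc, so the order of \<open>c x\<close>
      and \<open>c y\<close> is forced and the adjacency can be read off from it.\<close>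
    then have "(x, y) \<in> CG_arcs V E A l \<or> (y, x) \<in> CG_arcs V E A l"
      using xy by (auto simp: CG_arcs_iff insert_commute)
    then show ?thesis
      using False arc[of x y] arc[of y x] xy
      by (auto simp: CG_arcs_iff insert_commute)
  qed
  then show ?L using R by (simp add: letter_realisation_def topological_ordering_def)
qed

theorem theorem3p2:
  fixes V :: "'v set" and E :: "'v set set"
    and \<Sigma> :: "'a set" and A :: "'a rel" and k :: nat
  assumes "decoder \<Sigma> A" and "card \<Sigma> = k"
    and "simple_graph V E"
  shows "(letter_graph V E \<Sigma> A \<longleftrightarrow>
            (\<exists>l \<in> V \<rightarrow> \<Sigma>. C1 V E \<Sigma> A l \<and> C2 V E \<Sigma> A l \<and> C3 V E \<Sigma> A l \<and> C4 V E A l))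
       \<and> (\<forall>l \<in> V \<rightarrow> \<Sigma>. C1 V E \<Sigma> A l \<and> C2 V E \<Sigma> A l \<and> C3 V E \<Sigma> A l \<and> C4 V E A l \<longrightarrow>
            (\<forall>p. topological_ordering V (CG_arcs V E A l) p \<longrightarrow>
                 letter_realisation V E \<Sigma> A l p))"
proof -
  have fin: "finite V" using assms(3) by (simp add: simple_graph_def)
  \<comment> \<open>This gives the second conjunct for every \<open>p\<close>; for the first,
    acyclicity supplies one such \<open>p\<close>.\<close>
  have realise: "letter_realisation V E \<Sigma> A l p"
    if "l \<in> V \<rightarrow> \<Sigma>" "C1 V E \<Sigma> A l" "C2 V E \<Sigma> A l" "C3 V E \<Sigma> A l"
      "topological_ordering V (CG_arcs V E A l) p" for l p
    using C123_imp_symmetric_pairs_ok[OF fin that(1-4)] that(1,5)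
    by (simp add: letter_realisation_iff)
  have "letter_graph V E \<Sigma> A"
    if "l \<in> V \<rightarrow> \<Sigma>" "C1 V E \<Sigma> A l" "C2 V E \<Sigma> A l" "C3 V E \<Sigma> A l" "C4 V E A l" for l
    using acyclic_imp_topological_ordering[OF fin _ CG_arcs_subset] that realise
    unfolding C4_def letter_graph_def by blast
  moreover have "\<exists>l \<in> V \<rightarrow> \<Sigma>. C1 V E \<Sigma> A l \<and> C2 V E \<Sigma> A l \<and> C3 V E \<Sigma> A l \<and> C4 V E A l"
    if G: "letter_graph V E \<Sigma> A"
  proof -
    obtain l c where l: "l \<in> V \<rightarrow> \<Sigma>" "symmetric_pairs_ok V E A l"
      "topological_ordering V (CG_arcs V E A l) c"
      using G unfolding letter_graph_def letter_realisation_iff by blast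
    \<comment> \<open>The ordering \<open>c\<close> of the given realisation itself certifies
      acyclicity.\<close>
    then have "C4 V E A l" using topological_ordering_imp_acyclic by (simp add: C4_def)
    then show ?thesis using l(1) symmetric_pairs_ok_imp_C123[OF l(2)] by blast
  qed
  ultimately show ?thesis using realise by blast
qed

end
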